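(* For every real $q>0$, put $C:=C_p(q):=\left((1-p)^{-q-1}-1\right)^{-1}$. Then $$\mathbb{P}\left(\omega:\frac{z_{n+1}(\omega)}{Z_n(\omega)}>q\right)\asymp\left(\frac{(C+1)^{C+1}}{C^{C}}\,p\,(1-p)^{C(1+q)+q}\right)^{n},$$ and the comparability constants may be chosen to be $c_1=1-p$ and $c_2=1$. That is, for all $n\in\mathbb{N}$, $$(1-p)\,\mathbb{P}\left(\frac{z_{n+1}}{Z_n}>q\right)\le\left(\frac{(C+1)^{C+1}}{C^{C}}\,p\,(1-p)^{C(1+q)+q}\right)^{n}\le\mathbb{P}\left(\frac{z_{n+1}}{Z_n}>q\right).$$
   Context: $\mathbb{N}=\{1,2,3,\dots\}$. Let $\omega=(\omega_i)_{i\in\mathbb{N}}$ be a Bernoulli process over the symbol space $\{1,\dots,r\}$ with probability vector $(p_1,\dots,p_r)$, i.e. under $\mathbb{P}$ the $\omega_i$ are i.i.d. with $\mathbb{P}(\omega_i=j)=p_j$. Fix a symbol $k\in\{1,\dots,r\}$ with $p:=p_k\in(0,1)$. Let $Z_0:=0$ and, for $n\ge1$, let $Z_n(\omega):=\inf\{\ell\in\mathbb{N}:\ell>Z_{n-1}(\omega),\ \omega_\ell=k\}$ (the $n$-th total waiting time) and $z_n(\omega):=Z_n(\omega)-Z_{n-1}(\omega)$ (the $n$-th waiting time). Positive real sequences $(a_n)$, $(b_n)$ are called comparable, $a_n\asymp b_n$, with comparability constants $c_1>0$ and $c_2>0$, if $c_1a_n\le b_n\le c_2a_n$ for all $n$.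 *)

theory Defs
  imports "HOL-Probability.Probability"
begin

text \<open>The symbol space is \<open>{1..r}\<close>; the process is indexed by the positive integers, so the
  value of \<open>X\<close> at index \<open>0\<close> is unconstrained.\<close>

definition probability_vector :: "nat \<Rightarrow> (nat \<Rightarrow> real) \<Rightarrow> bool" where
  "probability_vector r pv \<longleftrightarrow> (\<forall>j\<in>{1..r}. 0 \<le> pv j) \<and> (\<Sum>j=1..r. pv j) = 1"

definition bernoulli_process ::
    "'a measure \<Rightarrow> nat \<Rightarrow> (nat \<Rightarrow> real) \<Rightarrow> (nat \<Rightarrow> 'a \<Rightarrow> nat) \<Rightarrow> bool" where
  "bernoulli_process M r pv X \<longleftrightarrow>
     prob_space M \<and> probability_vector r pv \<and>
     prob_space.indep_vars M (\<lambda>_. count_space {1..r}) X {1..} \<and>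
     (\<forall>i\<in>{1..}. \<forall>j\<in>{1..r}. measure M {x \<in> space M. X i x = j} = pv j)"

text \<open>Waiting times are extended naturals, so that the infimum of the empty set is \<open>\<infinity>\<close>.\<close>

primrec total_waiting_time :: "nat \<Rightarrow> (nat \<Rightarrow> nat) \<Rightarrow> nat \<Rightarrow> enat" where
  "total_waiting_time k w 0 = 0"
| "total_waiting_time k w (Suc n) =
     (INF l\<in>{l. 1 \<le> l \<and> total_waiting_time k w n < enat l \<and> w l = k}. enat l)"

text \<open>Meaningful for \<open>n \<ge> 1\<close>. The convention \<open>\<infinity> - \<infinity> = \<infinity>\<close> of \<open>enat\<close> only matters for
  sequences in which \<open>k\<close> occurs finitely often.\<close>

definition waiting_time :: "nat \<Rightarrow> (nat \<Rightarrow> nat) \<Rightarrow> nat \<Rightarrow> enat" where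
  "waiting_time k w n = total_waiting_time k w n - total_waiting_time k w (n - 1)"

text \<open>Sequences are indexed by the positive integers.\<close>

definition comparable_with ::
    "real \<Rightarrow> real \<Rightarrow> (nat \<Rightarrow> real) \<Rightarrow> (nat \<Rightarrow> real) \<Rightarrow> bool" where
  "comparable_with c1 c2 a b \<longleftrightarrow>
     0 < c1 \<and> 0 < c2 \<and> (\<forall>n\<ge>1. 0 < a n \<and> 0 < b n) \<and>
     (\<forall>n\<ge>1. c1 * a n \<le> b n \<and> b n \<le> c2 * a n)"

definition comparable :: "(nat \<Rightarrow> real) \<Rightarrow> (nat \<Rightarrow> real) \<Rightarrow> bool" where
  "comparable a b \<longleftrightarrow> (\<exists>c1 c2. comparable_with c1 c2 a b)"

definition ratio_const :: "real \<Rightarrow> real \<Rightarrow> real" where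
  "ratio_const p q = inverse ((1 - p) powr (- q - 1) - 1)"

text \<open>The event \<open>z\<^sub>n\<^sub>+\<^sub>1 / Z\<^sub>n > q\<close>; the quotient is taken in the extended reals.\<close>

definition ratio_event ::
    "'a measure \<Rightarrow> (nat \<Rightarrow> 'a \<Rightarrow> nat) \<Rightarrow> nat \<Rightarrow> real \<Rightarrow> nat \<Rightarrow> 'a set" where
  "ratio_event M X k q n =
     {x \<in> space M.
        ereal_of_enat (waiting_time k (\<lambda>i. X i x) (n + 1)) /
        ereal_of_enat (total_waiting_time k (\<lambda>i. X i x) n) > ereal q}"

end

theory Submission
  imports Defs
begin

text \<open>
  Write \<open>s = 1 - p\<close>. If the \<open>n\<close>-th occurrence of \<open>k\<close> is at time \<open>m\<close>, then the ratio exceeds \<open>q\<close>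
  exactly when \<open>k\<close> stays absent for the next \<open>\<lfloor>q m\<rfloor>\<close> steps. Both conditions together say that the
  set of occurrences up to time \<open>m + \<lfloor>q m\<rfloor>\<close> consists of \<open>n\<close> elements with maximum \<open>m\<close>. Each such set has
  probability \<open>p\<^sup>n s\<^bsup>m + \<lfloor>q m\<rfloor> - n\<^esup>\<close>, and counting them with \<open>m = n + j\<close> gives the exact formula
  of \<open>ratio_prob_sums\<close>: the probability is the sum over \<open>j\<close> of
  \<open>((n + j - 1) choose j) p\<^sup>n s\<^bsup>j + \<lfloor>q (n + j)\<rfloor>\<^esup>\<close>.

  If the floor is dropped, this becomes a negative binomial series in \<open>y = s\<^bsup>1 + q\<^esup>\<close> with the
  sum \<open>(p s\<^bsup>q\<^esup> / (1 - y))\<^sup>n\<close>, and \<open>decay_rate_eq\<close> identifies its base with the expression in \<open>C\<close>.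
  Dropping the floor changes the exponent of \<open>s\<close> by an amount in \<open>[0, 1)\<close>, hence every term by a
  factor between \<open>s\<close> and \<open>1\<close>; these are the two comparability constants.

  The description of the event holds for every sequence, including those in which \<open>k\<close> occurs only
  finitely often: there the total waiting time may be infinite, and the quotient is then \<open>0\<close>.
\<close>

section \<open>Waiting times in terms of occurrence sets\<close>

definition occurrences :: "nat \<Rightarrow> (nat \<Rightarrow> nat) \<Rightarrow> nat \<Rightarrow> nat set" where
  "occurrences k w N = {i\<in>{1..N}. w i = k}"

lemma finite_occurrences [simp]: "finite (occurrences k w N)"
  by (simp add: occurrences_def)

lemma occurrences_mono: "N \<le> N' \<Longrightarrow> occurrences k w N \<subseteq> occurrences k w N'"
  by (auto simp: occurrences_def)

lemma occurrences_Suc: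
  "occurrences k w (Suc N) =
     (if w (Suc N) = k then insert (Suc N) (occurrences k w N) else occurrences k w N)"
  by (auto simp: occurrences_def le_Suc_eq)

text \<open>The witness \<open>j\<close> is any occurrence that has at least \<open>n\<close> predecessors. This is the recursion of
  the waiting times, transcribed to counting.\<close>

lemma Suc_le_card_occurrences_iff:
  "Suc n \<le> card (occurrences k w l) \<longleftrightarrow>
     (\<exists>j. 1 \<le> j \<and> j \<le> l \<and> n \<le> card (occurrences k w (j - 1)) \<and> w j = k)"
proof (induction l)
  case 0
  then show ?case by (simp add: occurrences_def)
next
  case (Suc l)
  show ?case
  proof (cases "w (Suc l) = k")
    case True
    have "Suc l \<notin> occurrences k w l" by (simp add: occurrences_def)
    then have card: "card (occurrences k w (Suc l)) = Suc (card (occurrences k w l))"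
      using True by (simp add: occurrences_Suc)
    have le: "card (occurrences k w (j - 1)) \<le> card (occurrences k w l)" if "j \<le> Suc l" for j
      using that by (intro card_mono occurrences_mono) auto
    show ?thesis
    proof
      assume "Suc n \<le> card (occurrences k w (Suc l))"
      then show "\<exists>j. 1 \<le> j \<and> j \<le> Suc l \<and> n \<le> card (occurrences k w (j - 1)) \<and> w j = k"
        using True card by (intro exI[of _ "Suc l"]) simp
    next
      assume "\<exists>j. 1 \<le> j \<and> j \<le> Suc l \<and> n \<le> card (occurrences k w (j - 1)) \<and> w j = k"
      then show "Suc n \<le> card (occurrences k w (Suc l))"
        using card le le_trans by fastforce
    qed
  next
    case False
    then show ?thesis
      using Suc.IH by (auto simp: occurrences_Suc le_Suc_eq)
  qed
qed

text \<open>Waiting times and counting are inverse to each other in the sense of a Galois connection. As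
  an equivalence between inequalities it passes through the infimum in the recursion, and the
  value of the waiting time follows by comparing two consecutive bounds.\<close>

lemma total_waiting_time_le_iff:
  "total_waiting_time k w n \<le> enat l \<longleftrightarrow> n \<le> card (occurrences k w l)"
proof (induction n arbitrary: l)
  case 0
  then show ?case by simp
next
  case (Suc n)
  have less: "total_waiting_time k w n < enat j \<longleftrightarrow> n \<le> card (occurrences k w (j - 1))"
    if "1 \<le> j" for j
    using that Suc.IH[of "j - 1"] by (cases j; cases "total_waiting_time k w n") auto
  \<comment> \<open>An infimum lies strictly below a bound iff some member does; for the weak inequality
    this needs attainment, so the bound is first moved up by one.\<close>
  have "total_waiting_time k w (Suc n) \<le> enat l \<longleftrightarrow>
        total_waiting_time k w (Suc n) < enat (Suc l)"
    by (cases "total_waiting_time k w (Suc n)") auto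
  also have "\<dots> \<longleftrightarrow>
      (\<exists>j. 1 \<le> j \<and> j \<le> l \<and> total_waiting_time k w n < enat j \<and> w j = k)"
    by (simp add: INF_less_iff less_Suc_eq_le) blast
  also have "\<dots> \<longleftrightarrow> (\<exists>j. 1 \<le> j \<and> j \<le> l \<and> n \<le> card (occurrences k w (j - 1)) \<and> w j = k)"
    using less by blast
  finally show ?case by (simp add: Suc_le_card_occurrences_iff)
qed

text \<open>The possible sets of occurrence times when the \<open>n\<close>-th one is at \<open>m\<close> and no later one is
  seen.\<close>

definition hitting_sets :: "nat \<Rightarrow> nat \<Rightarrow> nat set set" where
  "hitting_sets n m = {S. S \<subseteq> {1..m} \<and> m \<in> S \<and> card S = n}"

lemma finite_hitting_sets [simp]: "finite (hitting_sets n m)"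
  by (rule finite_subset[of _ "Pow {1..m}"]) (auto simp: hitting_sets_def)

lemma total_waiting_time_eq_iff:
  assumes "n \<ge> 1"
  shows "total_waiting_time k w n = enat m \<longleftrightarrow> occurrences k w m \<in> hitting_sets n m"
proof (cases m)
  case 0
  have "\<not> total_waiting_time k w n \<le> enat 0"
    using assms unfolding total_waiting_time_le_iff by (simp add: occurrences_def)
  then show ?thesis
    using 0 by (auto simp: hitting_sets_def)
next
  case (Suc l)
  have "Suc l \<notin> occurrences k w l" by (simp add: occurrences_def)
  then have card: "card (occurrences k w (Suc l)) =
      (if w (Suc l) = k then Suc (card (occurrences k w l)) else card (occurrences k w l))"
    by (simp add: occurrences_Suc)
  have "total_waiting_time k w n = enat m \<longleftrightarrow>
      total_waiting_time k w n \<le> enat (Suc l) \<and> \<not> total_waiting_time k w n \<le> enat l"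
    by (cases "total_waiting_time k w n") (auto simp: Suc)
  also have "\<dots> \<longleftrightarrow> w (Suc l) = k \<and> card (occurrences k w (Suc l)) = n"
    unfolding total_waiting_time_le_iff using card by auto
  also have "\<dots> \<longleftrightarrow> occurrences k w m \<in> hitting_sets n m"
    by (auto simp: Suc hitting_sets_def occurrences_def)
  finally show ?thesis .
qed

text \<open>Observing the process up to a later time \<open>N\<close> adds the requirement that \<open>k\<close> is absent
  between \<open>m\<close> and \<open>N\<close>. Hence one occurrence set encodes both the waiting time and the gap after
  it, and the joint probability of the two follows directly from the independence of the symbols.\<close>

lemma occurrences_in_hitting_sets_iff:
  assumes "n \<ge> 1" "m \<le> N"
  shows "occurrences k w N \<in> hitting_sets n m \<longleftrightarrow>
    total_waiting_time k w n = enat m \<and> card (occurrences k w N) \<le> n"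
proof -
  have sub: "occurrences k w m \<subseteq> occurrences k w N"
    using assms(2) by (rule occurrences_mono)
  have eq: "occurrences k w N = occurrences k w m" if "occurrences k w N \<subseteq> {1..m}"
    using that sub by (auto simp: occurrences_def)
  have eq': "occurrences k w N = occurrences k w m"
    if "card (occurrences k w N) \<le> card (occurrences k w m)"
    using card_seteq[OF _ sub that] by simp
  show ?thesis
    unfolding total_waiting_time_eq_iff[OF assms(1)]
    using eq eq' by (auto simp: hitting_sets_def)
qed

text \<open>With \<open>m\<close> the value of the total waiting time, the gap \<open>m' - m\<close> exceeds \<open>q m\<close> iff it exceeds
  \<open>\<lfloor>q m\<rfloor>\<close>, because it is an integer. If \<open>k\<close> does not occur again, the ratio is \<open>\<infinity>\<close> and the absence
  condition holds as well. If \<open>k\<close> occurs fewer than \<open>n\<close> times, the ratio is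
  \<open>\<infinity> / \<infinity> = 0\<close> in the extended reals, and no \<open>m\<close> exists on the right.\<close>

lemma ratio_gt_iff:
  assumes "n \<ge> 1" "0 < q"
  shows "ereal_of_enat (waiting_time k w (n + 1)) / ereal_of_enat (total_waiting_time k w n) > ereal q
    \<longleftrightarrow> (\<exists>m. occurrences k w (m + nat \<lfloor>q * real m\<rfloor>) \<in> hitting_sets n m)"
    (is "?ratio \<longleftrightarrow> (\<exists>m. ?ev m)")
proof (cases "total_waiting_time k w n")
  case (enat m)
  have m: "m \<ge> 1"
    using enat total_waiting_time_le_iff[of k w n 0] assms(1)
    by (cases m) (auto simp: occurrences_def zero_enat_def)
  define f where "f = nat \<lfloor>q * real m\<rfloor>"
  have "?ratio \<longleftrightarrow> \<not> total_waiting_time k w (n + 1) \<le> enat (m + f)"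
  proof (cases "total_waiting_time k w (n + 1)")
    case (enat m')
    have "\<not> total_waiting_time k w (n + 1) \<le> enat m"
      using \<open>total_waiting_time k w n = enat m\<close> total_waiting_time_eq_iff[OF assms(1), of k w m]
      unfolding total_waiting_time_le_iff by (auto simp: hitting_sets_def)
    then have "m < m'" using enat by simp
    have "?ratio \<longleftrightarrow> q < real (m' - m) / real m"
      using enat \<open>total_waiting_time k w n = enat m\<close> m by (simp add: waiting_time_def)
    also have "\<dots> \<longleftrightarrow> q * real m < of_int (int (m' - m))"
      using m by (simp add: field_simps)
    also have "\<dots> \<longleftrightarrow> f < m' - m"
      unfolding f_def floor_less_iff[symmetric] using assms(2) by (simp add: nat_less_iff)
    finally show ?thesis
      using enat \<open>m < m'\<close> by auto
  next
    case infinity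
    then show ?thesis
      using \<open>total_waiting_time k w n = enat m\<close> m by (simp add: waiting_time_def)
  qed
  also have "\<dots> \<longleftrightarrow> card (occurrences k w (m + f)) \<le> n"
    unfolding total_waiting_time_le_iff by auto
  also have "\<dots> \<longleftrightarrow> (\<exists>m. ?ev m)"
    using enat assms(1) by (simp add: occurrences_in_hitting_sets_iff f_def)
  finally show ?thesis .
next
  case infinity
  then have "\<not> ?ev m" for m
    using assms(1) by (simp add: occurrences_in_hitting_sets_iff)
  then show ?thesis
    using infinity assms(2) by simp
qed

text \<open>Since \<open>m = n + j\<close> is a forced member, what remains is to choose the other \<open>n - 1\<close> elements
  below it.\<close>

lemma card_hitting_sets:
  assumes "n \<ge> 1"
  shows "card (hitting_sets n (n + j)) = (n + j - 1) choose j"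
proof -
  define m where "m = n + j"
  define T where "T = {B. B \<subseteq> {1..<m} \<and> card B = n - 1}"
  have "hitting_sets n m = insert m ` T"
  proof (intro equalityI subsetI)
    fix S assume S: "S \<in> hitting_sets n m"
    then have "finite S" by (auto simp: hitting_sets_def intro: finite_subset)
    then have "S - {m} \<in> T"
      using S unfolding hitting_sets_def T_def by fastforce
    moreover have "S = insert m (S - {m})"
      using S by (auto simp: hitting_sets_def)
    ultimately show "S \<in> insert m ` T" by blast
  next
    fix S assume "S \<in> insert m ` T"
    then obtain B where B: "B \<subseteq> {1..<m}" "card B = n - 1" "S = insert m B"
      by (auto simp: T_def)
    then have "finite B" "m \<notin> B" by (auto intro: finite_subset)
    then show "S \<in> hitting_sets n m"
      using B assms by (auto simp: hitting_sets_def m_def)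
  qed
  moreover have "inj_on (insert m) T"
  proof (rule inj_onI)
    fix B B' assume "B \<in> T" "B' \<in> T" "insert m B = insert m B'"
    moreover from this have "m \<notin> B" "m \<notin> B'" by (auto simp: T_def)
    ultimately show "B = B'" by (simp add: insert_ident)
  qed
  ultimately have "card (hitting_sets n m) = card T" by (simp add: card_image)
  also have "\<dots> = (m - 1) choose (n - 1)"
    unfolding T_def by (subst n_subsets) auto
  also have "\<dots> = (m - 1) choose j"
    using assms binomial_symmetric[of "n - 1" "m - 1"] by (simp add: m_def)
  finally show ?thesis by (simp add: m_def)
qed

lemma hitting_sets_empty:
  assumes "m < n"
  shows "hitting_sets n m = {}"
proof -
  have "card S \<noteq> n" if "S \<subseteq> {1..m}" for S
    using card_mono[OF _ that] assms by simp
  then show ?thesis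
    unfolding hitting_sets_def by blast
qed

section \<open>Probabilities of occurrence sets\<close>

lemma prob_occurrences_eq:
  assumes bp: "bernoulli_process M r pv X" and k: "k \<in> {1..r}" and S: "S \<subseteq> {1..N}"
  defines "E \<equiv> {x \<in> space M. occurrences k (\<lambda>i. X i x) N = S}"
  shows "E \<in> sets M" and "measure M E = pv k ^ card S * (1 - pv k) ^ (N - card S)"
proof -
  interpret prob_space M using bp by (simp add: bernoulli_process_def)
  have indep: "indep_vars (\<lambda>_. count_space {1..r}) X {1..}"
    and pk: "\<And>i. i \<ge> 1 \<Longrightarrow> prob {x \<in> space M. X i x = k} = pv k"
    using bp k by (auto simp: bernoulli_process_def)
  have rv: "X i \<in> measurable M (count_space {1..r})" if "i \<ge> 1" for i
    using indep that by (auto simp: indep_vars_def2)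
  \<comment> \<open>Prescribing the whole occurrence set prescribes for each single time whether \<open>k\<close> is hit or
    missed, so the event is an intersection of independent ones.\<close>
  define A where "A i = (if i \<in> S then {k} else {1..r} - {k})" for i
  have hit: "{x \<in> space M. X i x = k} = X i -` {k} \<inter> space M" for i
    by auto
  have meas: "X i -` A i \<inter> space M \<in> events" if "i \<ge> 1" for i
    using rv[OF that] k by (intro measurable_sets[OF rv[OF that]]) (auto simp: A_def)
  have prob: "prob (X i -` A i \<inter> space M) = (if i \<in> S then pv k else 1 - pv k)" if "i \<ge> 1" for i
  proof (cases "i \<in> S")
    case True
    then show ?thesis using pk[OF that] by (simp add: A_def hit)
  next
    case False
    have "X i -` A i \<inter> space M = space M - {x \<in> space M. X i x = k}"
      using False measurable_space[OF rv[OF that]] by (auto simp: A_def)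
    moreover have "{x \<in> space M. X i x = k} \<in> events"
      unfolding hit using k by (intro measurable_sets[OF rv[OF that]]) auto
    ultimately show ?thesis using pk[OF that] False by (simp add: prob_compl)
  qed
  have "E \<in> events \<and> prob E = pv k ^ card S * (1 - pv k) ^ (N - card S)"
  \<comment> \<open>For \<open>N = 0\<close> the intersection used below is empty and would be \<open>UNIV\<close> instead of
    \<open>space M\<close>.\<close>
  proof (cases "N = 0")
    case True
    then have "S = {}" using S by auto
    then have "E = space M" using True by (auto simp: E_def occurrences_def)
    then show ?thesis using True \<open>S = {}\<close> by (simp add: prob_space)
  next
    case False
    have "E = (\<Inter>i\<in>{1..N}. X i -` A i \<inter> space M)"
    proof (intro equalityI subsetI)
      fix x assume "x \<in> E"
      then have x: "x \<in> space M" "\<And>i. i \<in> {1..N} \<Longrightarrow> X i x = k \<longleftrightarrow> i \<in> S"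
        by (auto simp: E_def occurrences_def)
      then show "x \<in> (\<Inter>i\<in>{1..N}. X i -` A i \<inter> space M)"
        using measurable_space[OF rv, of _ x] by (auto simp: A_def)
    next
      fix x assume x: "x \<in> (\<Inter>i\<in>{1..N}. X i -` A i \<inter> space M)"
      have "x \<in> space M" using x False by auto
      moreover have "X i x = k \<longleftrightarrow> i \<in> S" if "i \<in> {1..N}" for i
        using x that by (auto simp: A_def split: if_splits)
      ultimately show "x \<in> E" using S by (auto simp: E_def occurrences_def)
    qed
    moreover have "(\<Inter>i\<in>{1..N}. X i -` A i \<inter> space M) \<in> events"
      using False meas by (intro sets.finite_INT) auto
    moreover have "prob (\<Inter>i\<in>{1..N}. X i -` A i \<inter> space M)
        = (\<Prod>i\<in>{1..N}. prob (X i -` A i \<inter> space M))"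
      using False k by (intro indep_varsD[OF indep]) (auto simp: A_def)
    moreover have "\<dots> = (\<Prod>i\<in>{1..N}. if i \<in> S then pv k else 1 - pv k)"
      by (intro prod.cong prob) auto
    moreover have "\<dots> = pv k ^ card S * (1 - pv k) ^ (N - card S)"
    proof -
      have "{1..N} \<inter> {i. i \<in> S} = S" "{1..N} \<inter> - {i. i \<in> S} = {1..N} - S"
        using S by auto
      then show ?thesis
        using S finite_subset[OF S] by (simp add: prod.If_cases card_Diff_subset)
    qed
    ultimately show ?thesis by simp
  qed
  then show "E \<in> sets M" "measure M E = pv k ^ card S * (1 - pv k) ^ (N - card S)"
    by auto
qed

text \<open>The event is cut first by the value \<open>n + j\<close> of the total waiting time, which no two of the
  countably many pieces share, and each piece then by the finitely many occurrence sets
  that realise it.\<close>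

lemma ratio_prob_sums:
  assumes bp: "bernoulli_process M r pv X" and k: "k \<in> {1..r}" and "0 < q" "n \<ge> 1"
  shows "(\<lambda>j. real ((n + j - 1) choose j) *
           (pv k ^ n * (1 - pv k) ^ (j + nat \<lfloor>q * real (n + j)\<rfloor>)))
         sums measure M (ratio_event M X k q n)"
proof -
  interpret prob_space M using bp by (simp add: bernoulli_process_def)
  define N where "N j = n + j + nat \<lfloor>q * real (n + j)\<rfloor>" for j
  define B where "B j S = {x \<in> space M. occurrences k (\<lambda>i. X i x) (N j) = S}" for j S
  define A where "A j = (\<Union>S\<in>hitting_sets n (n + j). B j S)" for j
  have S: "S \<subseteq> {1..N j}" "card S = n" if "S \<in> hitting_sets n (n + j)" for S j
    using that by (auto simp: hitting_sets_def N_def)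
  note B = prob_occurrences_eq[OF bp k S(1), folded B_def]
  have ratio: "ratio_event M X k q n = (\<Union>j. A j)"
  proof -
    have "(\<exists>m. occurrences k w (m + nat \<lfloor>q * real m\<rfloor>) \<in> hitting_sets n m) \<longleftrightarrow>
          (\<exists>j. occurrences k w (N j) \<in> hitting_sets n (n + j))" for w
      unfolding N_def by (metis empty_iff hitting_sets_empty le_add_diff_inverse not_le)
    then show ?thesis
      unfolding ratio_event_def ratio_gt_iff[OF \<open>n \<ge> 1\<close> \<open>0 < q\<close>] by (auto simp: A_def B_def)
  qed
  have "disjoint_family A"
    unfolding disjoint_family_on_def
  proof (intro ballI impI)
    fix i j :: nat assume "i \<noteq> j"
    have "x \<notin> A j" if "x \<in> A i" for x
    proof
      assume "x \<in> A j"
      have "total_waiting_time k (\<lambda>i. X i x) n = enat (n + l)" if "x \<in> A l" for l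
        using that \<open>n \<ge> 1\<close>
        by (auto simp: A_def B_def N_def occurrences_in_hitting_sets_iff)
      from this[OF \<open>x \<in> A i\<close>] this[OF \<open>x \<in> A j\<close>] show False
        using \<open>i \<noteq> j\<close> by simp
    qed
    then show "A i \<inter> A j = {}" by auto
  qed
  moreover have "range A \<subseteq> events"
    using B(1) by (auto simp: A_def intro!: sets.finite_UN)
  ultimately have "(\<lambda>j. prob (A j)) sums measure M (ratio_event M X k q n)"
    unfolding ratio by (intro finite_measure_UNION)
  moreover have "prob (A j) = real ((n + j - 1) choose j) *
           (pv k ^ n * (1 - pv k) ^ (j + nat \<lfloor>q * real (n + j)\<rfloor>))" for j
  proof -
    have "prob (A j) = (\<Sum>S\<in>hitting_sets n (n + j). prob (B j S))"
      unfolding A_def using B(1)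
      by (intro finite_measure_finite_Union) (auto simp: disjoint_family_on_def B_def)
    also have "\<dots> = (\<Sum>S\<in>hitting_sets n (n + j). pv k ^ n * (1 - pv k) ^ (N j - n))"
      using B(2) S(2) by (intro sum.cong) auto
    finally show ?thesis
      using card_hitting_sets[OF \<open>n \<ge> 1\<close>] by (simp add: N_def add.assoc)
  qed
  ultimately show ?thesis by simp
qed

section \<open>Comparison with the negative binomial series\<close>

text \<open>This is the binomial series for the exponent \<open>- n\<close> at the argument \<open>- y\<close>, in which the signs
  cancel.\<close>

lemma negative_binomial_series:
  fixes y :: real
  assumes "\<bar>y\<bar> < 1" "n \<ge> 1"
  shows "(\<lambda>j. real ((n + j - 1) choose j) * y ^ j) sums (1 / (1 - y)) ^ n"
proof -
  have "(\<lambda>j. ((- real n) gchoose j) * (- y) ^ j) sums (1 + - y) powr (- real n)"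
    using assms by (intro gen_binomial_real) simp
  moreover have "((- real n) gchoose j) * (- y) ^ j = real ((n + j - 1) choose j) * y ^ j" for j
  proof -
    have "(- real n) gchoose j = (- 1) ^ j * real ((n + j - 1) choose j)"
      using assms(2) by (simp add: gbinomial_minus binomial_gbinomial of_nat_diff)
    moreover have "(- y) ^ j = (- 1) ^ j * y ^ j"
      by (simp flip: power_mult_distrib)
    ultimately show ?thesis by (simp flip: power_mult_distrib)
  qed
  moreover have "(1 + - y) powr (- real n) = (1 / (1 - y)) ^ n"
    using assms by (simp add: powr_minus powr_realpow power_one_over inverse_eq_divide)
  ultimately show ?thesis by simp
qed

text \<open>With \<open>y = (1 - p)\<^bsup>1 + q\<^esup>\<close> the constant is \<open>C = y / (1 - y)\<close>, so \<open>C = (C + 1) y\<close>. Thus the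
  quotient of powers is \<open>(C + 1) y\<^bsup>- C\<^esup>\<close>; the factor \<open>y\<^bsup>- C\<^esup>\<close> cancels against the last one, and
  \<open>C + 1 = 1 / (1 - y)\<close>.\<close>

lemma decay_rate_eq:
  fixes p q :: real
  assumes "0 < p" "p < 1" "0 < q"
  defines "C \<equiv> ratio_const p q"
  shows "(C + 1) powr (C + 1) / C powr C * p * (1 - p) powr (C * (1 + q) + q)
    = p * (1 - p) powr q / (1 - (1 - p) powr (1 + q))"
proof -
  define y where "y = (1 - p) powr (1 + q)"
  have y: "0 < y" "y < 1"
    using assms powr01_less_one[of "1 - p" "1 + q"] by (auto simp: y_def)
  have "- q - 1 = - (1 + q)" by simp
  then have "(1 - p) powr (- q - 1) = 1 / y"
    unfolding y_def by (simp only: powr_minus_divide)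
  then have "C = inverse (1 / y - 1)"
    by (simp only: C_def ratio_const_def)
  then have C: "C = y / (1 - y)"
    using y by (simp add: field_simps)
  then have C1: "C + 1 = 1 / (1 - y)" and Cy: "C = (C + 1) * y"
    using y by (simp_all add: field_simps)
  have pos: "0 < C + 1" using C1 y by simp
  have "C powr C = (C + 1) powr C * y powr C"
    using Cy pos y powr_mult[of "C + 1" y C] by simp
  moreover have "(1 - p) powr (C * (1 + q) + q) = y powr C * (1 - p) powr q"
    by (simp only: powr_add[of _ "C * (1 + q)" q] y_def powr_powr mult.commute[of "1 + q" C])
  moreover have "(C + 1) powr (C + 1) = (C + 1) powr C * (C + 1)"
    using pos by (simp add: powr_add)
  moreover have "y powr C > 0" "(C + 1) powr C > 0"
    using pos y by auto
  ultimately have "(C + 1) powr (C + 1) / C powr C * p * (1 - p) powr (C * (1 + q) + q)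
      = (C + 1) * p * (1 - p) powr q"
    by (simp add: field_simps)
  then show ?thesis by (simp add: C1 y_def)
qed

theorem theorem1:
  fixes M :: "'a measure" and X :: "nat \<Rightarrow> 'a \<Rightarrow> nat"
    and r k :: nat and pv :: "nat \<Rightarrow> real" and p q C :: real
  assumes "bernoulli_process M r pv X"
    and "k \<in> {1..r}"
    and "p = pv k"
    and "0 < p" and "p < 1"
    and "0 < q"
    and "C = ratio_const p q"
  shows "comparable
           (\<lambda>n. measure M (ratio_event M X k q n))
           (\<lambda>n. ((C + 1) powr (C + 1) / C powr C * p * (1 - p) powr (C * (1 + q) + q)) ^ n)
       \<and> comparable_with (1 - p) 1
           (\<lambda>n. measure M (ratio_event M X k q n))
           (\<lambda>n. ((C + 1) powr (C + 1) / C powr C * p * (1 - p) powr (C * (1 + q) + q)) ^ n)"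
proof -
  define s where "s = 1 - p"
  define y where "y = s powr (1 + q)"
  define b where "b = p * s powr q / (1 - y)"
  have s: "0 < s" "s < 1" using assms by (auto simp: s_def)
  have y: "0 < y" "y < 1"
    using s assms(6) powr01_less_one[of s "1 + q"] by (auto simp: y_def)
  have b: "(C + 1) powr (C + 1) / C powr C * p * (1 - p) powr (C * (1 + q) + q) = b"
    using decay_rate_eq[OF assms(4-6)] by (simp add: assms(7) b_def s_def y_def)
  have b_pos: "b > 0" using assms(4) s y by (simp add: b_def)
  have bounds: "s * measure M (ratio_event M X k q n) \<le> b ^ n \<and>
      b ^ n \<le> measure M (ratio_event M X k q n)" if n: "n \<ge> 1" for n
  proof -
    define f where "f j = nat \<lfloor>q * real (n + j)\<rfloor>" for j
    \<comment> \<open>The exact series and the one without the floor share these coefficients, which makes a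
      comparison term by term possible.\<close>
    define c where "c j = real ((n + j - 1) choose j) * p ^ n * s ^ j" for j
    have c: "c j \<ge> 0" for j using assms(4) s by (simp add: c_def)
    have prob: "(\<lambda>j. c j * s ^ f j) sums measure M (ratio_event M X k q n)"
      using ratio_prob_sums[OF assms(1,2,6) n]
      by (simp add: c_def f_def s_def assms(3) power_add mult.assoc)
    have smooth: "(\<lambda>j. c j * s powr (q * real (n + j))) sums b ^ n"
    proof -
      have "(\<lambda>j. (p * s powr q) ^ n * (real ((n + j - 1) choose j) * y ^ j))
          sums ((p * s powr q) ^ n * (1 / (1 - y)) ^ n)"
        using y n by (intro sums_mult negative_binomial_series) auto
      moreover have "(p * s powr q) ^ n * (1 / (1 - y)) ^ n = b ^ n"
        by (simp add: b_def power_divide)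
      moreover have "(p * s powr q) ^ n * (real ((n + j - 1) choose j) * y ^ j)
          = c j * s powr (q * real (n + j))" for j
      proof -
        have "y ^ j = s ^ j * (s powr q) ^ j"
          using s by (simp add: y_def powr_add power_mult_distrib)
        moreover have "s powr (q * real (n + j)) = (s powr q) ^ n * (s powr q) ^ j"
          using s by (simp add: powr_powr[symmetric] powr_realpow power_add
              del: of_nat_add)
        ultimately show ?thesis
          by (simp add: c_def power_mult_distrib mult_ac)
      qed
      ultimately show ?thesis by simp
    qed
    have floor: "real (f j) \<le> q * real (n + j)" "q * real (n + j) \<le> real (f j) + 1" for j
    proof -
      have "0 \<le> q * real (n + j)" using assms(6) by simp
      then show "real (f j) \<le> q * real (n + j)" "q * real (n + j) \<le> real (f j) + 1"
        unfolding f_def by linarith+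
    qed
    have "s powr (q * real (n + j)) \<le> s ^ f j" for j
      using powr_mono'[OF floor(1)[of j], of s] s by (simp add: powr_realpow)
    then have upper: "b ^ n \<le> measure M (ratio_event M X k q n)"
      using c by (intro sums_le[OF _ smooth prob] mult_left_mono)
    have "s * s ^ f j \<le> s powr (q * real (n + j))" for j
      using powr_mono'[OF floor(2)[of j], of s] s by (simp add: powr_realpow powr_add mult.commute)
    then have "c j * (s * s ^ f j) \<le> c j * s powr (q * real (n + j))" for j
      using c by (intro mult_left_mono)
    then have "s * (c j * s ^ f j) \<le> c j * s powr (q * real (n + j))" for j
      by (simp only: mult.left_commute)
    then have lower: "s * measure M (ratio_event M X k q n) \<le> b ^ n"
      by (rule sums_le[OF _ sums_mult[OF prob] smooth])
    from lower upper show ?thesis ..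
  qed
  have "comparable_with (1 - p) 1 (\<lambda>n. measure M (ratio_event M X k q n)) (\<lambda>n. b ^ n)"
    using bounds b_pos s less_le_trans[OF zero_less_power[OF b_pos]]
    by (auto simp: comparable_with_def s_def)
  then show ?thesis
    unfolding b comparable_def by blast
qed

end
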